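(* Let $G$ be a finite group, $X$ a finite $G$-set, $r\ge1$ an integer, $A$ a finite set with $|A|\ge2$, $a\in A$, $N_c=\{0,1\}$, $P=A^r$ ($r$-fold cartesian product) and $p=(a,\dots,a)\in P$. Suppose there exist a finite group $G'$ containing $G$ as a subgroup and a finite $G'$-set $Y$ such that $[\mathrm{Res}^{G'}_G(Y)]=r[X]$ in the Burnside ring $B(G)$ (i.e. $\mathrm{Res}^{G'}_G(Y)$ is $G$-isomorphic to a disjoint union of $r$ copies of $X$). Then the $G$-set $J_{N_c,P,p}(X)$ is $G$-isomorphic to $\mathrm{Res}^{G'}_G(J_{N_c,A,a}(Y))$. In particular, for every $H\in\Phi(G)$, \[\mu_H(J_{N_c,P,p}(X))=\sum_{V\in\Phi(G')}c_V(H)\,\mu_V(J_{N_c,A,a}(Y)),\] where $c_V(H)=\mu_H(\mathrm{Res}^{G'}_G(G'/V))$.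
   Context: For a finite group $K$, a finite $K$-set $Z$, a finite set $C$ with $|C|\ge2$ and $c\in C$: let $C'=C\setminus\{c\}$, $C'^{[1]}$ the maps $\{1\}\to C'$, $C'^{[0]}=\{c\}$; $J_{N_c,C,c}(Z)$ is the set of maps $f:Z\to C'^{[0]}\sqcup C'^{[1]}$ with $K$-action $(kf)(z)=f(k^{-1}z)$. $\mathrm{Res}^{G'}_G$ means regarding a $G'$-set as a $G$-set. $\Phi(G)$, $\Phi(G')$ are the sets of conjugacy classes of subgroups. For a finite $G$-set $Z$, $\mu_H(Z)$ is the number of $G$-orbits isomorphic to $G/H$; for a finite $G'$-set $W$, $\mu_V(W)$ is the number of $G'$-orbits isomorphic to $G'/V$. $B(G)$ is the Grothendieck ring of finite $G$-sets under disjoint union and product. *)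

theory Defs
  imports "HOL-Algebra.Group_Action" "HOL-Algebra.Left_Coset" "HOL-Algebra.Ring"
begin

text \<open>
  A \<open>K\<close>-set is given by its underlying set and its action in the sense of \<^locale>\<open>group_action\<close>.
  Actions there are extensional, which is why the constructions below use restricted
  lambda abstractions.
\<close>

type_synonym ('g, 'x) gset = "'x set \<times> ('g \<Rightarrow> 'x \<Rightarrow> 'x)"

definition finite_gset :: "('g, 'm) monoid_scheme \<Rightarrow> ('g, 'x) gset \<Rightarrow> bool"
  where "finite_gset K Z \<longleftrightarrow> group_action K (fst Z) (snd Z) \<and> finite (fst Z)"

definition gset_iso :: "('g, 'm) monoid_scheme \<Rightarrow> ('g, 'x) gset \<Rightarrow> ('g, 'y) gset \<Rightarrow> bool"
  where "gset_iso K Z W \<longleftrightarrow>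
    (\<exists>f. bij_betw f (fst Z) (fst W) \<and>
         (\<forall>k\<in>carrier K. \<forall>z\<in>fst Z. f (snd Z k z) = snd W k (f z)))"

definition gset_res :: "('g, 'm) monoid_scheme \<Rightarrow> ('g, 'x) gset \<Rightarrow> ('g, 'x) gset"
  where "gset_res G Z = (fst Z, restrict (snd Z) (carrier G))"

definition gset_sum :: "('g, 'x) gset \<Rightarrow> ('g, 'y) gset \<Rightarrow> ('g, 'x + 'y) gset"
  where "gset_sum Z W =
    (fst Z <+> fst W, \<lambda>g. restrict (map_sum (snd Z g) (snd W g)) (fst Z <+> fst W))"

definition gset_prod :: "('g, 'x) gset \<Rightarrow> ('g, 'y) gset \<Rightarrow> ('g, 'x \<times> 'y) gset"
  where "gset_prod Z W =
    (fst Z \<times> fst W, \<lambda>g. restrict (map_prod (snd Z g) (snd W g)) (fst Z \<times> fst W))"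

definition gset_empty :: "('g, unit) gset"
  where "gset_empty = ({}, \<lambda>g. restrict id {})"

definition gset_point :: "('g, unit) gset"
  where "gset_point = (UNIV, \<lambda>g. id)"

definition coset_gset :: "('g, 'm) monoid_scheme \<Rightarrow> 'g set \<Rightarrow> ('g, 'g set) gset"
  where "coset_gset K H = (lcosets\<^bsub>K\<^esub> H, \<lambda>g. \<lambda>C\<in>lcosets\<^bsub>K\<^esub> H. g <#\<^bsub>K\<^esub> C)"


text \<open>
  The Burnside ring \<open>B(K)\<close>. To obtain a set of representatives of all finite \<open>K\<close>-sets, those with
  underlying set in \<^typ>\<open>nat\<close> are used. The formal difference \<open>[Z] - [W]\<close> of the Grothendieck
  construction is the set of all pairs \<open>(S, T)\<close> of such \<open>K\<close>-sets for which
  \<open>Z + T + U\<close> and \<open>S + W + U\<close> are isomorphic for some finite \<open>K\<close>-set \<open>U\<close>; here \<open>Z\<close> and \<open>W\<close> may have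
  elements of any type. In the sum and the product, all sets in the union are equal,
  because the operations respect the equivalence.
\<close>

definition burnside_diff ::
    "('g, 'm) monoid_scheme \<Rightarrow> ('g, 'x) gset \<Rightarrow> ('g, 'y) gset \<Rightarrow> (('g, nat) gset \<times> ('g, nat) gset) set"
  where "burnside_diff K Z W =
    {(S, T). finite_gset K S \<and> finite_gset K T \<and>
       (\<exists>U :: ('g, nat) gset. finite_gset K U \<and>
          gset_iso K (gset_sum (gset_sum Z T) U) (gset_sum (gset_sum S W) U))}"

definition burnside_ring ::
    "('g, 'm) monoid_scheme \<Rightarrow> (('g, nat) gset \<times> ('g, nat) gset) set ring"
  where "burnside_ring K =
    \<lparr>carrier = {burnside_diff K S T | (S :: ('g, nat) gset) (T :: ('g, nat) gset).
                  finite_gset K S \<and> finite_gset K T},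
     mult = (\<lambda>p q. \<Union>(S, T)\<in>p. \<Union>(S', T')\<in>q.
               burnside_diff K (gset_sum (gset_prod S S') (gset_prod T T'))
                               (gset_sum (gset_prod S T') (gset_prod T S'))),
     one = burnside_diff K gset_point gset_empty,
     zero = burnside_diff K gset_empty gset_empty,
     add = (\<lambda>p q. \<Union>(S, T)\<in>p. \<Union>(S', T')\<in>q.
               burnside_diff K (gset_sum S S') (gset_sum T T'))\<rparr>"

definition burnside_class ::
    "('g, 'm) monoid_scheme \<Rightarrow> ('g, 'x) gset \<Rightarrow> (('g, nat) gset \<times> ('g, nat) gset) set"
  where "burnside_class K Z = burnside_diff K Z gset_empty"


text \<open>
  \<open>\<Phi>(K)\<close>: the orbits of the conjugation action of \<open>K\<close> on its subgroups.
\<close>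

definition subgroup_classes :: "('g, 'm) monoid_scheme \<Rightarrow> 'g set set set"
  where "subgroup_classes K =
    orbits K {H. subgroup H K}
      (\<lambda>g. \<lambda>H\<in>{H. subgroup H K}. g <#\<^bsub>K\<^esub> H #>\<^bsub>K\<^esub> (inv\<^bsub>K\<^esub> g))"

text \<open>
  \<open>\<mu>\<^sub>H(Z)\<close>, for a subgroup \<open>H\<close> representing its conjugacy class.
\<close>

definition orbit_mult :: "('g, 'm) monoid_scheme \<Rightarrow> 'g set \<Rightarrow> ('g, 'x) gset \<Rightarrow> nat"
  where "orbit_mult K H Z =
    card {Q \<in> orbits K (fst Z) (snd Z).
            gset_iso K (Q, \<lambda>g. restrict (snd Z g) Q) (coset_gset K H)}"

definition res_coeff ::
    "('g, 'm) monoid_scheme \<Rightarrow> ('g, 'm) monoid_scheme \<Rightarrow> 'g set \<Rightarrow> 'g set \<Rightarrow> nat"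
  where "res_coeff G' G V H = orbit_mult G H (gset_res G (coset_gset G' V))"


text \<open>
  \<open>J_Nc K C c Z\<close> is \<open>J\<^bsub>N\<^sub>c,C,c\<^esub>(Z)\<close> for \<open>N\<^sub>c = {0, 1}\<close>. With \<open>C' = C - {c}\<close>, the summand \<open>{c}\<close> is
  \<open>C'\<^bsup>[0]\<^esup>\<close> and the summand of maps \<open>{1} \<rightarrow> C'\<close> is \<open>C'\<^bsup>[1]\<^esup>\<close>.
\<close>

definition J_Nc :: "('g, 'm) monoid_scheme \<Rightarrow> 'c set \<Rightarrow> 'c \<Rightarrow> ('g, 'x) gset
    \<Rightarrow> ('g, 'x \<Rightarrow> 'c + (nat \<Rightarrow> 'c)) gset"
  where "J_Nc K C c Z =
    (let M = fst Z \<rightarrow>\<^sub>E ({c} <+> ({1} \<rightarrow>\<^sub>E (C - {c})))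
     in (M, \<lambda>k. \<lambda>f\<in>M. \<lambda>z\<in>fst Z. f (snd Z (inv\<^bsub>K\<^esub> k) z)))"

end

theory Submission
  imports Defs
begin

text \<open>
  Two finite \<open>K\<close>-sets are isomorphic iff, for each \<open>H\<close>, they have the same number of orbits
  isomorphic to \<open>K/H\<close>. These numbers are additive, so a formal difference in \<open>B(K)\<close> is determined
  by its integer multiplicities; hence the equation in \<open>B(G)\<close> yields a \<open>G\<close>-isomorphism
  \<open>{1..r} \<times> X \<rightarrow> Y\<close>. As \<open>J(Z)\<close> is the set of maps from \<open>Z\<close> to the alphabet, the first claim is
  currying, \<open>(A\<^sup>r)\<^sup>X = A\<^bsup>{1..r} \<times> X\<^esup>\<close>. For the second, every \<open>G\<close>-orbit of a
  \<open>G'\<close>-set lies in a unique \<open>G'\<close>-orbit, which is isomorphic to \<open>G'/V\<close> for exactly one class of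
  subgroups \<open>V\<close>, the stabilizers of its points.
\<close>

section \<open>Group actions\<close>

abbreviation gset :: "('g, 'm) monoid_scheme \<Rightarrow> ('g, 'x) gset \<Rightarrow> bool"
  where "gset K Z \<equiv> group_action K (fst Z) (snd Z)"

definition gset_sub :: "('g, 'x) gset \<Rightarrow> 'x set \<Rightarrow> ('g, 'x) gset"
  where "gset_sub Z Q = (Q, \<lambda>g. restrict (snd Z g) Q)"

text \<open>The multiple of \<open>Z\<close> by \<open>card I\<close>, encoded as a product with
  trivial action on the indices rather than as an iterated sum, so that maps out of it can be
  curried.\<close>

definition gset_copies :: "'i set \<Rightarrow> ('g, 'x) gset \<Rightarrow> ('g, 'i \<times> 'x) gset"
  where "gset_copies I Z =
    (I \<times> fst Z, \<lambda>g. restrict (map_prod id (snd Z g)) (I \<times> fst Z))"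

text \<open>The inverse group element acts as the inverse map, which gives bijectivity.
  Extensionality is required because the elements of \<open>BijGroup E\<close> are functions
  restricted to \<open>E\<close>.\<close>

lemma group_actionI:
  assumes "group K"
    and ext: "\<And>g. g \<in> carrier K \<Longrightarrow> \<phi> g \<in> extensional E"
    and closed: "\<And>g x. \<lbrakk>g \<in> carrier K; x \<in> E\<rbrakk> \<Longrightarrow> \<phi> g x \<in> E"
    and one: "\<And>x. x \<in> E \<Longrightarrow> \<phi> \<one>\<^bsub>K\<^esub> x = x"
    and mult: "\<And>g h x. \<lbrakk>g \<in> carrier K; h \<in> carrier K; x \<in> E\<rbrakk> \<Longrightarrow>
      \<phi> (g \<otimes>\<^bsub>K\<^esub> h) x = \<phi> g (\<phi> h x)"
  shows "group_action K E \<phi>"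
proof -
  interpret group K by fact
  have bij: "\<phi> g \<in> Bij E" if g: "g \<in> carrier K" for g
  proof -
    have "bij_betw (\<phi> g) E E"
    proof (rule bij_betw_byWitness[where f' = "\<phi> (inv\<^bsub>K\<^esub> g)"])
      show "\<forall>a\<in>E. \<phi> (inv\<^bsub>K\<^esub> g) (\<phi> g a) = a"
        using g mult[of "inv\<^bsub>K\<^esub> g" g] one by simp
      show "\<forall>a\<in>E. \<phi> g (\<phi> (inv\<^bsub>K\<^esub> g) a) = a"
        using g mult[of g "inv\<^bsub>K\<^esub> g"] one by simp
    qed (use g closed in auto)
    then show ?thesis
      using ext[OF g] by (simp add: Bij_def)
  qed
  have "\<phi> \<in> hom K (BijGroup E)"
  proof (rule homI)
    fix g h assume gh: "g \<in> carrier K" "h \<in> carrier K"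
    have "\<phi> (g \<otimes>\<^bsub>K\<^esub> h) = compose E (\<phi> g) (\<phi> h)"
    proof (rule extensionalityI[of _ E])
      show "\<phi> (g \<otimes>\<^bsub>K\<^esub> h) \<in> extensional E"
        using gh ext by simp
    qed (use gh mult in \<open>auto simp: compose_eq\<close>)
    then show "\<phi> (g \<otimes>\<^bsub>K\<^esub> h) = \<phi> g \<otimes>\<^bsub>BijGroup E\<^esub> \<phi> h"
      using bij gh by (simp add: BijGroup_def)
  qed (use bij in \<open>simp add: BijGroup_def\<close>)
  then show ?thesis
    by (intro group_action.intro group_hom.intro group_hom_axioms.intro group_BijGroup \<open>group K\<close>)
qed

context group_action
begin

lemma group_acting: "group G"
  using group_hom by (rule group_hom.axioms)

lemma action_closed: "\<lbrakk>g \<in> carrier G; x \<in> E\<rbrakk> \<Longrightarrow> \<phi> g x \<in> E"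
  using element_image by blast

lemma action_one: "x \<in> E \<Longrightarrow> \<phi> \<one> x = x"
  using id_eq_one by (metis restrict_apply')

lemma action_extensional: "g \<in> carrier G \<Longrightarrow> \<phi> g \<in> extensional E"
  using bij_prop0 Bij_imp_extensional by blast

lemma orbit_subset: "x \<in> E \<Longrightarrow> orbit G \<phi> x \<subseteq> E"
  by (auto simp: orbit_def action_closed)

lemma orbits_subset: "Q \<in> orbits G E \<phi> \<Longrightarrow> Q \<subseteq> E"
  using orbit_subset by (auto simp: orbits_def)

lemma orbit_eqI: "\<lbrakk>x \<in> E; y \<in> orbit G \<phi> x\<rbrakk> \<Longrightarrow> orbit G \<phi> y = orbit G \<phi> x"
  by (meson orbit_subset orbit_sym orbit_trans subset_antisym subset_iff)

lemma orbits_eq_orbit: "\<lbrakk>Q \<in> orbits G E \<phi>; x \<in> Q\<rbrakk> \<Longrightarrow> Q = orbit G \<phi> x"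
  using orbit_eqI by (auto simp: orbits_def)

lemma orbits_closed: "\<lbrakk>Q \<in> orbits G E \<phi>; g \<in> carrier G; x \<in> Q\<rbrakk> \<Longrightarrow> \<phi> g x \<in> Q"
  using orbits_eq_orbit by (fastforce simp: orbit_def)

lemma orbits_nonempty: "Q \<in> orbits G E \<phi> \<Longrightarrow> \<exists>x\<in>Q. x \<in> E"
  using orbit_refl by (auto simp: orbits_def)

text \<open>\<open>h x = g x\<close> holds iff \<open>inv g h\<close> fixes \<open>x\<close>, so the
  fibres of the orbit map are left cosets of the stabilizer. Conjugation of stabilizers and the
  identification of an orbit with a coset space both come from this.\<close>

lemma orbit_coset:
  assumes x: "x \<in> E" and g: "g \<in> carrier G"
  shows "{h \<in> carrier G. \<phi> h x = \<phi> g x} = g <# stabilizer G \<phi> x"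
proof -
  interpret group G by (rule group_acting)
  show ?thesis
  proof safe
    fix h assume h: "h \<in> carrier G" "\<phi> h x = \<phi> g x"
    have "\<phi> (inv g \<otimes> h) x = x"
      using assms h composition_rule orbit_sym_aux by simp
    then have "inv g \<otimes> h \<in> stabilizer G \<phi> x"
      using g h by (simp add: stabilizer_def)
    moreover have "h = g \<otimes> (inv g \<otimes> h)"
      using g h by (simp add: m_assoc[symmetric])
    ultimately show "h \<in> g <# stabilizer G \<phi> x"
      by (auto simp: l_coset_def)
  qed (use assms composition_rule in \<open>auto simp: l_coset_def stabilizer_def\<close>)
qed

text \<open>\<open>h\<close> fixes \<open>g x\<close> iff \<open>h g\<close> sends \<open>x\<close>
  to \<open>g x\<close>, that is, iff \<open>h g\<close> lies in the left coset of \<open>g\<close>;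
  then multiply by \<open>inv g\<close> on the right.\<close>

lemma stabilizer_image:
  assumes x: "x \<in> E" and g: "g \<in> carrier G"
  shows "stabilizer G \<phi> (\<phi> g x) = g <# stabilizer G \<phi> x #> inv g"
proof -
  interpret group G by (rule group_acting)
  show ?thesis
  proof (intro equalityI subsetI)
    fix h assume "h \<in> stabilizer G \<phi> (\<phi> g x)"
    then have h: "h \<in> carrier G" "\<phi> h (\<phi> g x) = \<phi> g x"
      by (auto simp: stabilizer_def)
    then have "h \<otimes> g \<in> g <# stabilizer G \<phi> x"
      using assms composition_rule orbit_coset[OF assms] by auto
    moreover have "h = h \<otimes> g \<otimes> inv g"
      using g h by (simp add: m_assoc)
    ultimately show "h \<in> g <# stabilizer G \<phi> x #> inv g"
      by (auto simp: r_coset_def)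
  next
    fix h assume "h \<in> g <# stabilizer G \<phi> x #> inv g"
    then obtain s where "s \<in> g <# stabilizer G \<phi> x" and hs: "h = s \<otimes> inv g"
      by (auto simp: r_coset_def)
    then have s: "s \<in> carrier G" "\<phi> s x = \<phi> g x"
      using orbit_coset[OF assms] by auto
    have "\<phi> h (\<phi> g x) = \<phi> (h \<otimes> g) x"
      using assms s hs composition_rule by simp
    also have "h \<otimes> g = s"
      using g s hs by (simp add: m_assoc)
    finally show "h \<in> stabilizer G \<phi> (\<phi> g x)"
      using s g hs by (simp add: stabilizer_def)
  qed
qed

end

section \<open>Isomorphisms and orbit multiplicities\<close>

lemma gset_iso_refl: "gset_iso K Z Z"
  unfolding gset_iso_def by (rule exI[of _ id]) auto

text \<open>Closure of \<open>Z\<close> under the action lets the inverse bijection cancel at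
  \<open>snd Z k z\<close>. Only \<open>Z\<close> is assumed to be an action, so \<open>W\<close>
  may be \<open>coset_gset K H\<close> for an arbitrary set \<open>H\<close>.\<close>

lemma gset_iso_sym:
  assumes "gset K Z" and "gset_iso K Z W"
  shows "gset_iso K W Z"
proof -
  interpret group_action K "fst Z" "snd Z" by fact
  obtain f where f: "bij_betw f (fst Z) (fst W)"
    and eq: "\<And>k z. k \<in> carrier K \<Longrightarrow> z \<in> fst Z \<Longrightarrow> f (snd Z k z) = snd W k (f z)"
    using assms(2) by (auto simp: gset_iso_def)
  let ?g = "inv_into (fst Z) f"
  have "?g (snd W k w) = snd Z k (?g w)" if "k \<in> carrier K" "w \<in> fst W" for k w
  proof -
    have z: "?g w \<in> fst Z" "f (?g w) = w"
      using f that by (auto simp: bij_betw_def inv_into_into f_inv_into_f)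
    have "?g (snd W k w) = ?g (f (snd Z k (?g w)))"
      using eq[OF that(1) z(1)] z by simp
    then show ?thesis
      using f that z by (simp add: action_closed bij_betw_inv_into_left)
  qed
  then show ?thesis
    unfolding gset_iso_def using bij_betw_inv_into[OF f] by blast
qed

lemma gset_iso_trans:
  assumes "gset_iso K Z W" and "gset_iso K W V"
  shows "gset_iso K Z V"
proof -
  obtain f g where "bij_betw f (fst Z) (fst W)" "bij_betw g (fst W) (fst V)"
    and "\<forall>k\<in>carrier K. \<forall>z\<in>fst Z. f (snd Z k z) = snd W k (f z)"
    and "\<forall>k\<in>carrier K. \<forall>z\<in>fst W. g (snd W k z) = snd V k (g z)"
    using assms unfolding gset_iso_def by blast
  then show ?thesis
    unfolding gset_iso_def
    by (intro exI[of _ "g \<circ> f"]) (auto intro: bij_betw_trans dest: bij_betw_apply)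
qed

lemma gset_gset_sub:
  assumes "gset K Z" and "Q \<in> orbits K (fst Z) (snd Z)"
  shows "gset K (gset_sub Z Q)"
proof -
  interpret group_action K "fst Z" "snd Z" by fact
  interpret group K by (rule group_acting)
  have "Q \<subseteq> fst Z"
    using orbits_subset assms(2) by blast
  then show ?thesis
    using orbits_closed[OF assms(2)] composition_rule action_one is_group
    by (intro group_actionI) (auto simp: gset_sub_def subset_iff)
qed

lemma orbit_mult_alt:
  "orbit_mult K H Z =
    card {Q \<in> orbits K (fst Z) (snd Z). gset_iso K (gset_sub Z Q) (coset_gset K H)}"
  by (simp add: orbit_mult_def gset_sub_def)

lemma orbit_equivariant:
  assumes "\<And>k. k \<in> carrier K \<Longrightarrow> f (snd Z k z) = snd W k (f z)"
  shows "orbit K (snd W) (f z) = f ` orbit K (snd Z) z"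
  using assms by (force simp: orbit_def)

text \<open>An injective equivariant map carries the orbits of \<open>Z\<close> bijectively to the
  orbits of \<open>W\<close> inside its image and preserves their types. Isomorphisms, the summands
  of a sum and the inclusion of a \<open>G'\<close>-orbit are all instances.\<close>

lemma orbit_mult_embedding:
  assumes Z: "gset K Z" and W: "gset K W"
    and inj: "inj_on f (fst Z)" and sub: "f ` fst Z \<subseteq> fst W"
    and eq: "\<And>k z. k \<in> carrier K \<Longrightarrow> z \<in> fst Z \<Longrightarrow> f (snd Z k z) = snd W k (f z)"
  shows "orbit_mult K H Z =
    card {Q \<in> orbits K (fst W) (snd W). Q \<subseteq> f ` fst Z \<and>
      gset_iso K (gset_sub W Q) (coset_gset K H)}"
    (is "_ = card ?R")
proof -
  let ?L = "{Q \<in> orbits K (fst Z) (snd Z). gset_iso K (gset_sub Z Q) (coset_gset K H)}"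
  interpret Z: group_action K "fst Z" "snd Z" by fact
  interpret W: group_action K "fst W" "snd W" by fact
  have orb: "f ` Q \<in> orbits K (fst W) (snd W)"
    and iso: "gset_iso K (gset_sub Z Q) (gset_sub W (f ` Q))"
    if Q: "Q \<in> orbits K (fst Z) (snd Z)" for Q
  proof -
    obtain z where "z \<in> fst Z" "Q = orbit K (snd Z) z"
      using Q by (auto simp: orbits_def)
    then show "f ` Q \<in> orbits K (fst W) (snd W)"
      using orbit_equivariant[of K f Z z W] eq sub
      by (auto simp: orbits_def intro!: exI[of _ "f z"])
    show "gset_iso K (gset_sub Z Q) (gset_sub W (f ` Q))"
      unfolding gset_iso_def gset_sub_def
      using Z.orbits_subset[OF Q] inj eq
      by (intro exI[of _ f]) (auto simp: bij_betw_def subset_iff intro: inj_on_subset)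
  qed
  have "bij_betw ((`) f) ?L ?R"
    unfolding bij_betw_def
  proof (intro conjI equalityI subsetI)
    show "inj_on ((`) f) ?L"
      using Z.orbits_subset inj
      by (intro inj_on_subset[OF inj_on_image_Pow[OF inj]]) auto
  next
    fix R assume "R \<in> (`) f ` ?L"
    then obtain Q where Q: "R = f ` Q" "Q \<in> orbits K (fst Z) (snd Z)"
      and H: "gset_iso K (gset_sub Z Q) (coset_gset K H)"
      by blast
    have "gset_iso K (gset_sub W R) (coset_gset K H)"
      using gset_iso_trans[OF gset_iso_sym[OF gset_gset_sub[OF Z Q(2)] iso[OF Q(2)]] H] Q
      by simp
    moreover have "R \<in> orbits K (fst W) (snd W)" "R \<subseteq> f ` fst Z"
      using orb[OF Q(2)] image_mono[OF Z.orbits_subset[OF Q(2)]] unfolding Q(1) by simp_all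
    ultimately show "R \<in> ?R"
      by (intro CollectI conjI)
  next
    \<comment> \<open>Surjectivity: an orbit inside the image contains some \<open>f z\<close>,
      hence is the image of the orbit of \<open>z\<close>.\<close>
    fix R assume R: "R \<in> ?R"
    then have orbR: "R \<in> orbits K (fst W) (snd W)"
      by simp
    then obtain w where w: "w \<in> R"
      using W.orbits_nonempty by blast
    then obtain z where z: "z \<in> fst Z" "w = f z"
      using R by blast
    have wR: "R = orbit K (snd W) w"
      using orbR w by (rule W.orbits_eq_orbit)
    have *: "R = f ` orbit K (snd Z) z"
      using wR z eq by (simp add: orbit_equivariant)
    have **: "orbit K (snd Z) z \<in> orbits K (fst Z) (snd Z)"
      using z by (auto simp: orbits_def)
    have "gset_iso K (gset_sub Z (orbit K (snd Z) z)) (coset_gset K H)"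
    proof (rule gset_iso_trans)
      show "gset_iso K (gset_sub Z (orbit K (snd Z) z)) (gset_sub W R)"
        using iso[OF **] unfolding *[symmetric] .
      show "gset_iso K (gset_sub W R) (coset_gset K H)"
        using R by simp
    qed
    then show "R \<in> (`) f ` ?L"
      using ** by (subst *) (intro imageI CollectI conjI)
  qed
  then show ?thesis
    by (simp add: orbit_mult_alt bij_betw_same_card)
qed

lemma orbit_mult_cong:
  assumes Z: "gset K Z" and W: "gset K W" and "gset_iso K Z W"
  shows "orbit_mult K H Z = orbit_mult K H W"
proof -
  interpret W: group_action K "fst W" "snd W" by fact
  obtain f where f: "bij_betw f (fst Z) (fst W)"
    and eq: "\<And>k z. k \<in> carrier K \<Longrightarrow> z \<in> fst Z \<Longrightarrow> f (snd Z k z) = snd W k (f z)"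
    using assms(3) by (auto simp: gset_iso_def)
  show ?thesis
    using f W.orbits_subset
    by (subst orbit_mult_embedding[OF Z W _ _ eq])
       (auto simp: bij_betw_def orbit_mult_alt intro: arg_cong[of _ _ card])
qed

section \<open>Additivity of orbit multiplicities\<close>

lemma finite_orbits: "finite (fst Z) \<Longrightarrow> finite (orbits K (fst Z) (snd Z))"
  by (simp add: orbits_def)

lemma finite_gset_sum:
  assumes "finite_gset K Z" "finite_gset K W"
  shows "finite_gset K (gset_sum Z W)"
proof -
  interpret Z: group_action K "fst Z" "snd Z" using assms by (simp add: finite_gset_def)
  interpret W: group_action K "fst W" "snd W" using assms by (simp add: finite_gset_def)
  interpret group K by (rule Z.group_acting)
  show ?thesis
    using assms Z.composition_rule W.composition_rule Z.action_one W.action_one is_group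
      Z.action_closed W.action_closed
    by (auto simp: finite_gset_def gset_sum_def intro!: group_actionI)
qed

lemma orbit_mult_sum:
  assumes Z: "finite_gset K Z" and W: "finite_gset K W"
  shows "orbit_mult K H (gset_sum Z W) = orbit_mult K H Z + orbit_mult K H W"
proof -
  let ?S = "gset_sum Z W"
  have S: "finite_gset K ?S"
    using assms by (rule finite_gset_sum)
  interpret S: group_action K "fst ?S" "snd ?S" using S by (simp add: finite_gset_def)
  interpret Z: group_action K "fst Z" "snd Z" using assms by (simp add: finite_gset_def)
  interpret W: group_action K "fst W" "snd W" using assms by (simp add: finite_gset_def)
  let ?O = "\<lambda>A. {Q \<in> orbits K (fst ?S) (snd ?S). Q \<subseteq> A \<and>
    gset_iso K (gset_sub ?S Q) (coset_gset K H)}"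
  have fS: "fst ?S = Inl ` fst Z \<union> Inr ` fst W"
    by (auto simp: gset_sum_def)
  \<comment> \<open>The action preserves the tags \<open>Inl\<close> and \<open>Inr\<close>, so no
    orbit meets both summands.\<close>
  have part: "Q \<subseteq> Inl ` fst Z \<or> Q \<subseteq> Inr ` fst W" if Q: "Q \<in> orbits K (fst ?S) (snd ?S)" for Q
  proof -
    obtain s where s: "s \<in> fst ?S" "Q = orbit K (snd ?S) s"
      using Q by (auto simp: orbits_def)
    then show ?thesis
      using Z.action_closed W.action_closed
      by (auto simp: fS orbit_def) (auto simp: gset_sum_def)
  qed
  have "{Q \<in> orbits K (fst ?S) (snd ?S). gset_iso K (gset_sub ?S Q) (coset_gset K H)} =
    ?O (Inl ` fst Z) \<union> ?O (Inr ` fst W)"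
    using part by blast
  moreover have "?O (Inl ` fst Z) \<inter> ?O (Inr ` fst W) = {}"
  proof (rule ccontr)
    assume "?O (Inl ` fst Z) \<inter> ?O (Inr ` fst W) \<noteq> {}"
    then obtain Q where Q: "Q \<in> orbits K (fst ?S) (snd ?S)" "Q \<subseteq> Inl ` fst Z" "Q \<subseteq> Inr ` fst W"
      by blast
    then show False
      using S.orbits_nonempty[OF Q(1)] by blast
  qed
  moreover have "finite (?O A)" for A
    using S by (simp add: finite_gset_def finite_orbits)
  moreover have "orbit_mult K H Z = card (?O (Inl ` fst Z))"
    using Z.group_action_axioms S.group_action_axioms
    by (rule orbit_mult_embedding) (auto simp: gset_sum_def)
  moreover have "orbit_mult K H W = card (?O (Inr ` fst W))"
    using W.group_action_axioms S.group_action_axioms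
    by (rule orbit_mult_embedding) (auto simp: gset_sum_def)
  ultimately show ?thesis
    by (simp add: orbit_mult_alt[of K H ?S] card_Un_disjoint)
qed

lemma finite_gset_copies:
  assumes "finite_gset K Z" "finite I"
  shows "finite_gset K (gset_copies I Z)"
proof -
  interpret group_action K "fst Z" "snd Z" using assms by (simp add: finite_gset_def)
  interpret group K by (rule group_acting)
  show ?thesis
    using assms composition_rule action_one is_group action_closed
    by (auto simp: finite_gset_def gset_copies_def intro!: group_actionI)
qed

lemma finite_gset_emptyI:
  assumes "group K"
  shows "finite_gset K ({}, \<lambda>g. restrict id {})"
  using assms by (auto simp: finite_gset_def intro!: group_actionI)

lemma orbit_mult_no_points: "fst Z = {} \<Longrightarrow> orbit_mult K H Z = 0"
  by (simp add: orbit_mult_def orbits_def)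

lemma orbit_mult_copies:
  assumes Z: "finite_gset K Z" and "finite I"
  shows "orbit_mult K H (gset_copies I Z) = card I * orbit_mult K H Z"
  using assms(2)
proof induction
  case empty
  then show ?case
    by (simp add: orbit_mult_no_points gset_copies_def)
next
  case (insert i I)
  \<comment> \<open>The first summand keeps its indices, and the second becomes the copy with the
    new index \<open>i\<close>.\<close>
  have "gset_iso K (gset_sum (gset_copies I Z) Z) (gset_copies (insert i I) Z)"
    unfolding gset_iso_def
  proof (intro exI conjI ballI)
    show "bij_betw (case_sum id (Pair i)) (fst (gset_sum (gset_copies I Z) Z))
        (fst (gset_copies (insert i I) Z))"
      using insert by (auto simp: bij_betw_def inj_on_def gset_sum_def gset_copies_def Plus_def image_Un image_image)
  qed (auto simp: gset_sum_def gset_copies_def)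
  then have "orbit_mult K H (gset_copies (insert i I) Z) =
      orbit_mult K H (gset_sum (gset_copies I Z) Z)"
    using finite_gset_sum[OF finite_gset_copies[OF Z insert(1)] Z]
      finite_gset_copies[OF Z, of "insert i I"] insert(1)
    by (intro orbit_mult_cong[symmetric]) (auto simp: finite_gset_def)
  also have "\<dots> = card (insert i I) * orbit_mult K H Z"
    using insert orbit_mult_sum[OF finite_gset_copies[OF Z insert(1)] Z] by simp
  finally show ?case .
qed

text \<open>Members of a Burnside class are pairs of \<open>K\<close>-sets on \<open>nat\<close>;
  this supplies them. The action is transported along an injection of the finite set into
  \<open>nat\<close>.\<close>

lemma finite_gset_nat_representative:
  assumes "finite_gset K Z"
  obtains S :: "('g, nat) gset" where "finite_gset K S" "gset_iso K Z S"
proof -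
  interpret group_action K "fst Z" "snd Z" using assms by (simp add: finite_gset_def)
  interpret group K by (rule group_acting)
  obtain f :: "'b \<Rightarrow> nat" where f: "inj_on f (fst Z)"
    using assms by (meson finite_gset_def finite_imp_inj_to_nat_seg)
  let ?S = "(f ` fst Z, \<lambda>g. \<lambda>n\<in>f ` fst Z. f (snd Z g (inv_into (fst Z) f n)))"
  have "gset K ?S"
    using f is_group composition_rule action_one action_closed
    by (intro group_actionI) (auto simp: inv_into_f_f inj_on_eq_iff[OF f])
  moreover have "gset_iso K Z ?S"
    unfolding gset_iso_def using f by (intro exI[of _ f]) (auto simp: bij_betw_def)
  ultimately show ?thesis
    using assms by (intro that[of ?S]) (auto simp: finite_gset_def)
qed

section \<open>Bijections assembled from fibres\<close>

lemma bij_betw_fibres: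
  assumes "\<And>i. bij_betw (h i) {a \<in> A. p a = i} {b \<in> B. q b = i}"
  shows "bij_betw (\<lambda>a. h (p a) a) A B"
proof -
  have h: "h (p a) a \<in> B" "q (h (p a) a) = p a" if "a \<in> A" for a
    using bij_betw_apply[OF assms[of "p a"], of a] that by auto
  show ?thesis
    unfolding bij_betw_def
  proof (intro conjI inj_onI equalityI subsetI)
    fix a a' assume aa: "a \<in> A" "a' \<in> A" "h (p a) a = h (p a') a'"
    then have "p a = p a'"
      using h by metis
    then show "a = a'"
      using aa assms[of "p a"] by (auto simp: bij_betw_def inj_on_def)
  next
    fix b assume "b \<in> B"
    then have "b \<in> h (q b) ` {a \<in> A. p a = q b}"
      using assms[of "q b"] by (simp add: bij_betw_def)
    then show "b \<in> (\<lambda>a. h (p a) a) ` A"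
      by force
  qed (use h in auto)
qed

text \<open>Fibres of equal size are in bijection, and these bijections glue to one that respects
  the labels. It will match orbits labelled by their isomorphism type.\<close>

lemma ex_bij_betw_fibres:
  assumes "finite A" "finite B"
    and "\<And>i. card {a \<in> A. p a = i} = card {b \<in> B. q b = i}"
  obtains \<sigma> where "bij_betw \<sigma> A B" "\<And>a. a \<in> A \<Longrightarrow> q (\<sigma> a) = p a"
proof -
  have "\<exists>h. bij_betw h {a \<in> A. p a = i} {b \<in> B. q b = i}" for i
    using assms by (intro finite_same_card_bij) auto
  then obtain h where h: "\<And>i. bij_betw (h i) {a \<in> A. p a = i} {b \<in> B. q b = i}"
    by metis
  show ?thesis
  proof (rule that)
    show "bij_betw (\<lambda>a. h (p a) a) A B"
      using h by (rule bij_betw_fibres)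
    show "q (h (p a) a) = p a" if "a \<in> A" for a
      using bij_betw_apply[OF h[of "p a"], of a] that by simp
  qed
qed

section \<open>Orbits as coset spaces, and classification by multiplicities\<close>

lemma orbit_iso_coset_gset:
  assumes Z: "gset K Z" and x: "x \<in> fst Z"
  shows "gset_iso K (gset_sub Z (orbit K (snd Z) x)) (coset_gset K (stabilizer K (snd Z) x))"
proof -
  interpret group_action K "fst Z" "snd Z" by fact
  interpret group K by (rule group_acting)
  let ?S = "stabilizer K (snd Z) x"
  \<comment> \<open>A point \<open>q\<close> of the orbit goes to the set of all group elements
    carrying \<open>x\<close> to \<open>q\<close>. This involves no choice of representative, and
    \<open>orbit_coset\<close> shows that it is a coset.\<close>
  let ?f = "\<lambda>q. {h \<in> carrier K. snd Z h x = q}"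
  have f: "?f (snd Z g x) = g <#\<^bsub>K\<^esub> ?S" if "g \<in> carrier K" for g
    using orbit_coset[OF x that] .
  have S: "subgroup ?S K"
    using stabilizer_subgroup[OF x] .
  have "bij_betw ?f (orbit K (snd Z) x) (lcosets\<^bsub>K\<^esub> ?S)"
    unfolding bij_betw_def
  proof (intro conjI inj_onI)
    fix q q' assume "q \<in> orbit K (snd Z) x" "?f q = ?f q'"
    then show "q = q'"
      by (auto simp: orbit_def)
  next
    show "?f ` orbit K (snd Z) x = lcosets\<^bsub>K\<^esub> ?S"
      using f by (auto simp: orbit_def LCOSETS_def)
  qed
  moreover have "?f (snd (gset_sub Z (orbit K (snd Z) x)) k q) =
      snd (coset_gset K ?S) k (?f q)"
    if k: "k \<in> carrier K" and q: "q \<in> orbit K (snd Z) x" for k q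
  proof -
    obtain g where g: "g \<in> carrier K" "q = snd Z g x"
      using q by (auto simp: orbit_def)
    have "?f (snd Z k q) = (k \<otimes>\<^bsub>K\<^esub> g) <#\<^bsub>K\<^esub> ?S"
      using f[of "k \<otimes>\<^bsub>K\<^esub> g"] k g x by (simp add: composition_rule)
    also have "\<dots> = k <#\<^bsub>K\<^esub> (g <#\<^bsub>K\<^esub> ?S)"
      using k g S by (simp add: lcos_m_assoc subgroup.subset)
    finally show ?thesis
      using f g q by (auto simp: gset_sub_def coset_gset_def LCOSETS_def)
  qed
  ultimately show ?thesis
    unfolding gset_iso_def by (intro exI[of _ ?f]) (simp add: gset_sub_def coset_gset_def)
qed

lemma orbit_iso_coset_gset_iff:
  assumes Z: "gset K Z" and Q: "Q \<in> orbits K (fst Z) (snd Z)" and H: "subgroup H K"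
  shows "gset_iso K (gset_sub Z Q) (coset_gset K H) \<longleftrightarrow> (\<exists>x\<in>Q. stabilizer K (snd Z) x = H)"
proof
  interpret group_action K "fst Z" "snd Z" by fact
  interpret group K by (rule group_acting)
  assume "gset_iso K (gset_sub Z Q) (coset_gset K H)"
  then obtain f where f: "bij_betw f Q (lcosets\<^bsub>K\<^esub> H)"
    and eq: "\<And>k q. k \<in> carrier K \<Longrightarrow> q \<in> Q \<Longrightarrow> f (snd Z k q) = k <#\<^bsub>K\<^esub> f q"
    unfolding gset_iso_def gset_sub_def coset_gset_def by (auto simp: bij_betw_apply)
  have "H = \<one>\<^bsub>K\<^esub> <#\<^bsub>K\<^esub> H"
    using H by (simp add: lcos_mult_one subgroup.subset)
  then have "H \<in> lcosets\<^bsub>K\<^esub> H"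
    by (auto simp: LCOSETS_def)
  \<comment> \<open>The point corresponding to the coset \<open>H\<close> has stabilizer
    \<open>H\<close>, as \<open>g\<close> fixes that coset exactly when \<open>g\<close> is in
    \<open>H\<close>.\<close>
  then obtain x where x: "x \<in> Q" "f x = H"
    using f by (metis bij_betw_def imageE)
  have "snd Z g x = x \<longleftrightarrow> g \<in> H" if g: "g \<in> carrier K" for g
  proof -
    have "snd Z g x = x \<longleftrightarrow> g <#\<^bsub>K\<^esub> H = H"
      using f x eq[OF g x(1)] orbits_closed[OF Q g x(1)]
      by (metis bij_betw_inv_into_left)
    also have "\<dots> \<longleftrightarrow> g \<in> H"
      using g H lcos_self coset_join3 by blast
    finally show ?thesis .
  qed
  then have "stabilizer K (snd Z) x = H"
    using subgroup.subset[OF H] by (auto simp: stabilizer_def)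
  then show "\<exists>x\<in>Q. stabilizer K (snd Z) x = H"
    using x by blast
next
  interpret group_action K "fst Z" "snd Z" by fact
  assume "\<exists>x\<in>Q. stabilizer K (snd Z) x = H"
  then show "gset_iso K (gset_sub Z Q) (coset_gset K H)"
    using orbits_eq_orbit[OF Q] orbits_subset[OF Q] orbit_iso_coset_gset[OF Z] by blast
qed

text \<open>The set of all \<open>H'\<close> with \<open>V\<close> isomorphic to \<open>K/H'\<close>
  serves as the type of \<open>V\<close>. By transitivity any member determines it, so orbits
  sharing one member have equal types.\<close>

lemma orbit_type_eq:
  assumes "gset K V" "H \<in> {H'. gset_iso K V (coset_gset K H')}"
  shows "{H'. gset_iso K V (coset_gset K H')} =
    {H'. gset_iso K (coset_gset K H) (coset_gset K H')}"
proof -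
  have H: "gset_iso K V (coset_gset K H)"
    using assms(2) by simp
  show ?thesis
    by (intro Collect_cong iffI)
      (erule gset_iso_trans[OF gset_iso_sym[OF assms(1) H]], erule gset_iso_trans[OF H])
qed

text \<open>Equal multiplicities allow a bijection between the orbits of \<open>Z\<close> and
  \<open>W\<close> that preserves types; isomorphisms of matched orbits are then glued.\<close>

lemma gset_iso_if_orbit_mult_eq:
  assumes Z: "finite_gset K Z" and W: "finite_gset K W"
    and mult: "\<And>H. orbit_mult K H Z = orbit_mult K H W"
  shows "gset_iso K Z W"
proof -
  let ?OZ = "orbits K (fst Z) (snd Z)" and ?OW = "orbits K (fst W) (snd W)"
  have actZ: "gset K Z" and actW: "gset K W"
    using Z W by (simp_all add: finite_gset_def)
  interpret Z: group_action K "fst Z" "snd Z" by fact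
  interpret W: group_action K "fst W" "snd W" by fact
  let ?tZ = "\<lambda>Q. {H. gset_iso K (gset_sub Z Q) (coset_gset K H)}"
  let ?tW = "\<lambda>Q. {H. gset_iso K (gset_sub W Q) (coset_gset K H)}"
  have tZ: "?tZ Q \<noteq> {}" if "Q \<in> ?OZ" for Q
    using that orbit_iso_coset_gset[OF actZ] by (auto simp: orbits_def)
  have tW: "?tW Q \<noteq> {}" if "Q \<in> ?OW" for Q
    using that orbit_iso_coset_gset[OF actW] by (auto simp: orbits_def)
  \<comment> \<open>A label that is the type of some \<open>K/H\<close> is counted by the
    multiplicity of \<open>H\<close>. Any other label occurs on no orbit, since every orbit is
    isomorphic to some \<open>K/H\<close>.\<close>
  have cards: "card {Q \<in> ?OZ. ?tZ Q = t} = card {Q \<in> ?OW. ?tW Q = t}" for t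
  proof (cases "\<exists>H. t = {H'. gset_iso K (coset_gset K H) (coset_gset K H')}")
    case True
    then obtain H where H: "t = {H'. gset_iso K (coset_gset K H) (coset_gset K H')}"
      by blast
    then have "H \<in> t"
      by (simp add: gset_iso_refl)
    then have "?tZ Q = t \<longleftrightarrow> H \<in> ?tZ Q" if "Q \<in> ?OZ" for Q
      using orbit_type_eq[OF gset_gset_sub[OF actZ that], of H] H by blast
    moreover have "?tW Q = t \<longleftrightarrow> H \<in> ?tW Q" if "Q \<in> ?OW" for Q
      using orbit_type_eq[OF gset_gset_sub[OF actW that], of H] H \<open>H \<in> t\<close> by blast
    ultimately have "{Q \<in> ?OZ. ?tZ Q = t} = {Q \<in> ?OZ. H \<in> ?tZ Q}"
        "{Q \<in> ?OW. ?tW Q = t} = {Q \<in> ?OW. H \<in> ?tW Q}"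
      by blast+
    then show ?thesis
      using mult[of H] by (simp add: orbit_mult_alt)
  next
    case False
    have "?tZ Q \<noteq> t" if Q: "Q \<in> ?OZ" for Q
    proof -
      obtain H where "H \<in> ?tZ Q"
        using tZ[OF Q] by blast
      from orbit_type_eq[OF gset_gset_sub[OF actZ Q] this] show ?thesis
        using False by metis
    qed
    moreover have "?tW Q \<noteq> t" if Q: "Q \<in> ?OW" for Q
    proof -
      obtain H where "H \<in> ?tW Q"
        using tW[OF Q] by blast
      from orbit_type_eq[OF gset_gset_sub[OF actW Q] this] show ?thesis
        using False by metis
    qed
    ultimately have "{Q \<in> ?OZ. ?tZ Q = t} = {}" "{Q \<in> ?OW. ?tW Q = t} = {}"
      by blast+
    then show ?thesis
      by (simp only: card.empty)
  qed
  obtain \<sigma> where \<sigma>: "bij_betw \<sigma> ?OZ ?OW" and t\<sigma>: "\<And>Q. Q \<in> ?OZ \<Longrightarrow> ?tW (\<sigma> Q) = ?tZ Q"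
  proof (rule ex_bij_betw_fibres[of ?OZ ?OW ?tZ ?tW])
    show "finite ?OZ" "finite ?OW"
      using Z W by (simp_all add: finite_gset_def finite_orbits)
  qed (use cards in blast)+
  \<comment> \<open>Matched orbits have the same nonempty type, so both are isomorphic to a common
    \<open>K/H\<close>.\<close>
  have "gset_iso K (gset_sub Z Q) (gset_sub W (\<sigma> Q))" if Q: "Q \<in> ?OZ" for Q
  proof -
    obtain H where "H \<in> ?tZ Q" "H \<in> ?tW (\<sigma> Q)"
      using tZ[OF Q] t\<sigma>[OF Q] by blast
    then show ?thesis
      using gset_iso_trans gset_iso_sym[OF gset_gset_sub[OF actW]] bij_betw_apply[OF \<sigma> Q]
      by blast
  qed
  then have "\<exists>h. bij_betw h Q (\<sigma> Q) \<and> (\<forall>k\<in>carrier K. \<forall>z\<in>Q. h (snd Z k z) = snd W k (h z))"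
    if "Q \<in> ?OZ" for Q
    using that by (fastforce simp: gset_iso_def gset_sub_def bij_betw_apply)
  then obtain h where h: "\<And>Q. Q \<in> ?OZ \<Longrightarrow> bij_betw (h Q) Q (\<sigma> Q)"
    and heq: "\<And>Q k z. Q \<in> ?OZ \<Longrightarrow> k \<in> carrier K \<Longrightarrow> z \<in> Q \<Longrightarrow>
      h Q (snd Z k z) = snd W k (h Q z)"
    by metis
  let ?p = "\<lambda>z. orbit K (snd Z) z"
  have pO: "?p z \<in> ?OZ" if "z \<in> fst Z" for z
    using that by (auto simp: orbits_def)
  \<comment> \<open>\<open>bij_betw_fibres\<close> wants the map indexed by a label common to both
    sides. That label is the orbit in \<open>W\<close>, whence the detour through
    \<open>inv_into\<close>, removed again below.\<close>
  have "bij_betw (\<lambda>z. h (inv_into ?OZ \<sigma> (\<sigma> (?p z))) z) (fst Z) (fst W)"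
  proof (rule bij_betw_fibres[where q = "\<lambda>w. orbit K (snd W) w"])
    fix R
    show "bij_betw (h (inv_into ?OZ \<sigma> R)) {z \<in> fst Z. \<sigma> (?p z) = R}
      {w \<in> fst W. orbit K (snd W) w = R}"
    proof (cases "R \<in> ?OW")
      case True
      then obtain Q where Q: "Q \<in> ?OZ" "\<sigma> Q = R"
        using \<sigma> by (metis bij_betw_def imageE)
      have "\<sigma> (?p z) = R \<longleftrightarrow> z \<in> Q" if "z \<in> fst Z" for z
      proof -
        have "\<sigma> (?p z) = R \<longleftrightarrow> ?p z = Q"
          using Q \<sigma> pO[OF that] by (auto simp: bij_betw_def inj_on_def)
        then show ?thesis
          using Z.orbits_eq_orbit[OF Q(1)] Z.orbit_refl[OF that] by blast
      qed
      then have "{z \<in> fst Z. \<sigma> (?p z) = R} = Q"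
        using Z.orbits_subset[OF Q(1)] by blast
      moreover have "{w \<in> fst W. orbit K (snd W) w = R} = R"
        using W.orbits_subset[OF True] W.orbits_eq_orbit[OF True] W.orbit_refl by blast
      moreover have "inv_into ?OZ \<sigma> R = Q"
        using \<sigma> Q by (auto simp: bij_betw_def)
      ultimately show ?thesis
        using h[OF Q(1)] Q by simp
    next
      case False
      have "{z \<in> fst Z. \<sigma> (?p z) = R} = {}"
        using False bij_betw_apply[OF \<sigma>] pO by blast
      moreover have "{w \<in> fst W. orbit K (snd W) w = R} = {}"
        using False by (auto simp: orbits_def)
      ultimately show ?thesis
        by (simp only: bij_betw_def image_empty inj_on_empty simp_thms)
    qed
  qed
  moreover have "inv_into ?OZ \<sigma> (\<sigma> (?p z)) = ?p z" if "z \<in> fst Z" for z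
    using \<sigma> pO[OF that] by (simp add: bij_betw_def)
  ultimately have "bij_betw (\<lambda>z. h (?p z) z) (fst Z) (fst W)"
    by (simp cong: bij_betw_cong)
  moreover have "h (?p (snd Z k z)) (snd Z k z) = snd W k (h (?p z) z)"
    if "k \<in> carrier K" "z \<in> fst Z" for k z
  proof -
    have "snd Z k z \<in> ?p z"
      using that by (auto simp: orbit_def)
    then have "?p (snd Z k z) = ?p z"
      using Z.orbit_eqI that by blast
    then show ?thesis
      using heq[OF pO] that Z.orbit_refl by simp
  qed
  ultimately show ?thesis
    unfolding gset_iso_def by (intro exI[of _ "\<lambda>z. h (?p z) z"]) simp
qed

section \<open>The Burnside ring\<close>

text \<open>The summand \<open>U\<close> cancels from the counts, and equal counts conversely yield
  an isomorphism. Computations in \<open>B(K)\<close> thereby reduce to integer arithmetic of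
  multiplicities.\<close>

lemma burnside_diff_iff:
  assumes "finite_gset K Z" "finite_gset K W"
  shows "(S, T) \<in> burnside_diff K Z W \<longleftrightarrow> finite_gset K S \<and> finite_gset K T \<and>
    (\<forall>H. int (orbit_mult K H S) - int (orbit_mult K H T) =
      int (orbit_mult K H Z) - int (orbit_mult K H W))"
proof -
  have "group K"
    using assms(1) by (auto simp: finite_gset_def intro: group_action.group_acting)
  have "(\<exists>U :: ('a, nat) gset. finite_gset K U \<and>
          gset_iso K (gset_sum (gset_sum Z T) U) (gset_sum (gset_sum S W) U)) \<longleftrightarrow>
    (\<forall>H. int (orbit_mult K H S) - int (orbit_mult K H T) =
      int (orbit_mult K H Z) - int (orbit_mult K H W))" (is "?L \<longleftrightarrow> ?R")
    if S: "finite_gset K S" and T: "finite_gset K T"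
  proof
    assume ?L
    then obtain U :: "('a, nat) gset" where U: "finite_gset K U"
      and iso: "gset_iso K (gset_sum (gset_sum Z T) U) (gset_sum (gset_sum S W) U)"
      by blast
    have "orbit_mult K H (gset_sum (gset_sum Z T) U) =
        orbit_mult K H (gset_sum (gset_sum S W) U)" for H
      using assms S T U by (intro orbit_mult_cong iso) (meson finite_gset_def finite_gset_sum)+
    then have "orbit_mult K H Z + orbit_mult K H T = orbit_mult K H S + orbit_mult K H W" for H
      using assms S T U by (simp add: orbit_mult_sum finite_gset_sum)
    then show ?R
      by (simp add: algebra_simps flip: of_nat_add)
  next
    assume R: ?R
    \<comment> \<open>The empty set can serve as auxiliary summand, because multiplicities already
      determine the isomorphism type.\<close>
    let ?U = "({}, \<lambda>g. restrict id {}) :: ('a, nat) gset"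
    have U: "finite_gset K ?U"
      using \<open>group K\<close> by (rule finite_gset_emptyI)
    have "orbit_mult K H Z + orbit_mult K H T = orbit_mult K H S + orbit_mult K H W" for H
      using spec[OF R, of H] by linarith
    then have "gset_iso K (gset_sum (gset_sum Z T) ?U) (gset_sum (gset_sum S W) ?U)"
      using assms S T U by (intro gset_iso_if_orbit_mult_eq) (simp_all add: orbit_mult_sum finite_gset_sum)
    then show ?L
      using U by blast
  qed
  then show ?thesis
    by (auto simp: burnside_diff_def)
qed

lemma finite_gset_gset_empty: "group K \<Longrightarrow> finite_gset K gset_empty"
  unfolding gset_empty_def by (rule finite_gset_emptyI)

lemma orbit_mult_gset_empty: "orbit_mult K H gset_empty = 0"
  by (simp add: orbit_mult_no_points gset_empty_def)

text \<open>The last premise equates the two differences of multiplicities, with the negative terms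
  moved across so that it stays in \<open>nat\<close>.\<close>

lemma burnside_diff_cong:
  assumes "finite_gset K Z" "finite_gset K W" "finite_gset K Z'" "finite_gset K W'"
    and "\<And>H. orbit_mult K H Z + orbit_mult K H W' = orbit_mult K H Z' + orbit_mult K H W"
  shows "burnside_diff K Z W = burnside_diff K Z' W'"
proof -
  have "int (orbit_mult K H Z) - int (orbit_mult K H W) =
      int (orbit_mult K H Z') - int (orbit_mult K H W')" for H
    using assms(5)[of H] by linarith
  then show ?thesis
    using assms(1-4) by (auto simp: burnside_diff_iff)
qed

text \<open>Sums in the ring are unions over the members of classes; an empty class would make such
  a union collapse to the empty set.\<close>

lemma burnside_diff_nonempty:
  assumes Z: "finite_gset K Z" and W: "finite_gset K W"
  shows "burnside_diff K Z W \<noteq> {}"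
proof -
  obtain S :: "('a, nat) gset" where S: "finite_gset K S" "gset_iso K Z S"
    using finite_gset_nat_representative[OF Z] .
  obtain T :: "('a, nat) gset" where T: "finite_gset K T" "gset_iso K W T"
    using finite_gset_nat_representative[OF W] .
  have "(S, T) \<in> burnside_diff K Z W"
    using Z W S T orbit_mult_cong[of K Z S] orbit_mult_cong[of K W T]
    by (simp add: burnside_diff_iff finite_gset_def)
  then show ?thesis
    by blast
qed

text \<open>All sets in the union defining the sum have the same multiplicities, hence are equal; a
  union of one constant set over nonempty index sets is that set.\<close>

lemma burnside_diff_add:
  assumes "finite_gset K Z" "finite_gset K W" "finite_gset K Z'" "finite_gset K W'"
  shows "burnside_diff K Z W \<oplus>\<^bsub>burnside_ring K\<^esub> burnside_diff K Z' W' =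
    burnside_diff K (gset_sum Z Z') (gset_sum W W')"
proof -
  have eq: "burnside_diff K (gset_sum S S') (gset_sum T T') =
      burnside_diff K (gset_sum Z Z') (gset_sum W W')"
    if "(S, T) \<in> burnside_diff K Z W" "(S', T') \<in> burnside_diff K Z' W'" for S T S' T'
  proof -
    have ST: "finite_gset K S" "finite_gset K T" "finite_gset K S'" "finite_gset K T'"
      and d: "int (orbit_mult K H S) - int (orbit_mult K H T) =
        int (orbit_mult K H Z) - int (orbit_mult K H W)"
      and d': "int (orbit_mult K H S') - int (orbit_mult K H T') =
        int (orbit_mult K H Z') - int (orbit_mult K H W')" for H
      using that unfolding burnside_diff_iff[OF assms(1,2)] burnside_diff_iff[OF assms(3,4)]
      by blast+
    have "orbit_mult K H S + orbit_mult K H S' + (orbit_mult K H W + orbit_mult K H W') =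
        orbit_mult K H Z + orbit_mult K H Z' + (orbit_mult K H T + orbit_mult K H T')" for H
      using d[of H] d'[of H] by linarith
    then show ?thesis
      using assms ST by (intro burnside_diff_cong) (simp_all add: finite_gset_sum orbit_mult_sum)
  qed
  have "burnside_diff K Z W \<oplus>\<^bsub>burnside_ring K\<^esub> burnside_diff K Z' W' =
    (\<Union>p\<in>burnside_diff K Z W. \<Union>q\<in>burnside_diff K Z' W'.
      burnside_diff K (gset_sum Z Z') (gset_sum W W'))"
    unfolding burnside_ring_def ring_record_simps case_prod_beta
    by (intro SUP_cong refl eq) simp_all
  then show ?thesis
    by (simp only: UN_constant burnside_diff_nonempty assms if_False)
qed

text \<open>The multiple is iterated addition starting at zero. Each induction step compares
  multiplicities: those of the copies over \<open>{1..Suc r}\<close> are \<open>Suc r\<close> times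
  those of \<open>X\<close>.\<close>

lemma burnside_class_add_pow:
  fixes r :: nat
  assumes X: "finite_gset K X"
  shows "[r] \<cdot>\<^bsub>burnside_ring K\<^esub> burnside_class K X =
    burnside_class K (gset_copies {1..r} X)"
proof -
  have "group K"
    using assms(1) by (auto simp: finite_gset_def intro: group_action.group_acting)
  note empty = finite_gset_gset_empty[OF this]
  note copies = finite_gset_copies[OF X finite_atLeastAtMost]
  show ?thesis
  proof (induction r)
    case 0
    have "burnside_diff K gset_empty gset_empty =
        burnside_diff K (gset_copies {1..0::nat} X) gset_empty"
      by (intro burnside_diff_cong empty copies)
         (simp add: orbit_mult_copies[OF X] orbit_mult_gset_empty)
    then show ?case
      by (simp add: add_pow_def burnside_class_def nat_pow_def burnside_ring_def)
  next
    case (Suc r)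
    have "[Suc r] \<cdot>\<^bsub>burnside_ring K\<^esub> burnside_class K X =
      burnside_class K (gset_copies {1..r} X) \<oplus>\<^bsub>burnside_ring K\<^esub> burnside_class K X"
      using Suc by (simp add: add_pow_def nat_pow_def)
    also have "\<dots> = burnside_diff K (gset_sum (gset_copies {1..r} X) X)
        (gset_sum gset_empty gset_empty)"
      unfolding burnside_class_def by (intro burnside_diff_add copies empty X)
    also have "\<dots> = burnside_class K (gset_copies {1..Suc r} X)"
      unfolding burnside_class_def
      by (intro burnside_diff_cong finite_gset_sum copies empty X)
         (simp add: orbit_mult_sum copies empty X orbit_mult_copies[OF X] orbit_mult_gset_empty)
    finally show ?case .
  qed
qed

text \<open>Multiplicities are natural numbers, where addition cancels, so passing to formal
  differences loses no information about a finite \<open>K\<close>-set.\<close>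

lemma burnside_class_eq_iff:
  assumes Z: "finite_gset K Z" and W: "finite_gset K W"
  shows "burnside_class K Z = burnside_class K W \<longleftrightarrow> gset_iso K Z W"
proof -
  have "group K"
    using Z by (auto simp: finite_gset_def intro: group_action.group_acting)
  note empty = finite_gset_gset_empty[OF this]
  show ?thesis
  proof
    assume eq: "burnside_class K Z = burnside_class K W"
    \<comment> \<open>A pair in the common class records the multiplicities of \<open>Z\<close> and
      of \<open>W\<close> alike, so they agree for every \<open>H\<close>.\<close>
    obtain S T where ST: "(S, T) \<in> burnside_diff K Z gset_empty"
      using burnside_diff_nonempty[OF Z empty] by (metis ex_in_conv surj_pair)
    then have ST': "(S, T) \<in> burnside_diff K W gset_empty"
      using eq by (simp add: burnside_class_def)
    have "orbit_mult K H Z = orbit_mult K H W" for H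
      using ST ST' unfolding burnside_diff_iff[OF Z empty] burnside_diff_iff[OF W empty]
      by (metis diff_add_cancel of_nat_eq_iff)
    then show "gset_iso K Z W"
      by (intro gset_iso_if_orbit_mult_eq Z W)
  next
    assume "gset_iso K Z W"
    then have "orbit_mult K H Z = orbit_mult K H W" for H
      using Z W by (intro orbit_mult_cong) (simp_all add: finite_gset_def)
    then show "burnside_class K Z = burnside_class K W"
      unfolding burnside_class_def by (intro burnside_diff_cong Z W empty) simp
  qed
qed

section \<open>The sets of maps\<close>

text \<open>
  Identifies the alphabet \<open>{c} + ({1} \<rightarrow>\<^sub>E C - {c})\<close> of \<^const>\<open>J_Nc\<close> with \<open>C\<close>, so that \<open>J(Z)\<close> becomes the set of all maps \<open>Z \<rightarrow> C\<close>.
\<close>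

definition decode :: "'c + (nat \<Rightarrow> 'c) \<Rightarrow> 'c"
  where "decode = case_sum id (\<lambda>h. h 1)"

lemma bij_betw_decode:
  assumes "c \<in> C"
  shows "bij_betw decode ({c} <+> ({1} \<rightarrow>\<^sub>E (C - {c}))) C"
\<comment> \<open>The letter \<open>c\<close> is coded in the left summand, any other letter by the
  map on \<open>{1}\<close> with that value.\<close>
proof (rule bij_betw_byWitness[where f' = "\<lambda>x. if x = c then Inl c else Inr (\<lambda>i\<in>{1}. x)"])
  have *: "(\<lambda>i\<in>{1}. h 1) = h" if "h \<in> {1} \<rightarrow>\<^sub>E (C - {c})" for h :: "nat \<Rightarrow> 'a"
    by (rule extensionalityI[of _ "{1}"]) (use PiE_ext[OF that] that in \<open>simp_all add: PiE_iff\<close>)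
  show "\<forall>u\<in>{c} <+> ({1} \<rightarrow>\<^sub>E (C - {c})).
      (if decode u = c then Inl c else Inr (\<lambda>i\<in>{1}. decode u)) = u"
  proof
    fix u :: "'a + (nat \<Rightarrow> 'a)" assume "u \<in> {c} <+> ({1} \<rightarrow>\<^sub>E (C - {c}))"
    then show "(if decode u = c then Inl c else Inr (\<lambda>i\<in>{1}. decode u)) = u"
    proof (rule PlusE)
      fix h assume h: "h \<in> {1} \<rightarrow>\<^sub>E (C - {c})" "u = Inr h"
      then have "h 1 \<noteq> c"
        by (simp add: PiE_iff)
      then show ?thesis
        using h *[OF h(1)] by (simp add: decode_def)
    qed (simp add: decode_def)
  qed
  show "\<forall>x\<in>C. decode (if x = c then Inl c else Inr (\<lambda>i\<in>{1}. x)) = x"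
    by (simp add: decode_def)
  show "decode ` ({c} <+> ({1} \<rightarrow>\<^sub>E (C - {c}))) \<subseteq> C"
    using assms by (force simp: decode_def PiE_iff)
  show "(\<lambda>x. if x = c then Inl c else Inr (\<lambda>i\<in>{1}. x)) ` C \<subseteq> {c} <+> ({1} \<rightarrow>\<^sub>E (C - {c}))"
    by (intro image_subsetI) (simp add: InlI InrI restrict_PiE_iff)
qed

lemma fst_J_Nc: "fst (J_Nc K C c Z) = fst Z \<rightarrow>\<^sub>E ({c} <+> ({1} \<rightarrow>\<^sub>E (C - {c})))"
  by (simp add: J_Nc_def Let_def)

lemma snd_J_Nc:
  "f \<in> fst (J_Nc K C c Z) \<Longrightarrow>
    snd (J_Nc K C c Z) k f = (\<lambda>z\<in>fst Z. f (snd Z (inv\<^bsub>K\<^esub> k) z))"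
  by (simp add: J_Nc_def Let_def)

lemma finite_gset_J_Nc:
  assumes Z: "finite_gset K Z" and "finite C"
  shows "finite_gset K (J_Nc K C c Z)"
proof -
  interpret group_action K "fst Z" "snd Z" using assms by (simp add: finite_gset_def)
  interpret group K by (rule group_acting)
  let ?J = "J_Nc K C c Z"
  have closed: "snd ?J k f \<in> fst ?J" if "k \<in> carrier K" "f \<in> fst ?J" for k f
    unfolding snd_J_Nc[OF that(2)]
    using that inv_closed action_closed by (simp only: fst_J_Nc restrict_PiE_iff PiE_mem) blast
  have "group_action K (fst ?J) (snd ?J)"
  proof (rule group_actionI)
    show "snd ?J k \<in> extensional (fst ?J)" for k
      by (simp add: J_Nc_def Let_def)
    show "snd ?J \<one>\<^bsub>K\<^esub> f = f" if f: "f \<in> fst ?J" for f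
    proof -
      have "snd ?J \<one>\<^bsub>K\<^esub> f = (\<lambda>z\<in>fst Z. f z)"
        using action_one by (simp add: snd_J_Nc[OF f] cong: restrict_cong)
      also have "\<dots> = f"
        using f by (auto simp: fst_J_Nc PiE_iff intro: extensional_restrict)
      finally show ?thesis .
    qed
    show "snd ?J (g \<otimes>\<^bsub>K\<^esub> h) f = snd ?J g (snd ?J h f)"
      if gh: "g \<in> carrier K" "h \<in> carrier K" and f: "f \<in> fst ?J" for g h f
    proof -
      have "snd ?J g (snd ?J h f) = (\<lambda>z\<in>fst Z. snd ?J h f (snd Z (inv\<^bsub>K\<^esub> g) z))"
        by (rule snd_J_Nc[OF closed[OF gh(2) f]])
      \<comment> \<open>Inversion reverses products, which compensates for acting on arguments and
        yields a left action.\<close>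
      also have "\<dots> = (\<lambda>z\<in>fst Z. f (snd Z (inv\<^bsub>K\<^esub> (g \<otimes>\<^bsub>K\<^esub> h)) z))"
        using gh by (intro restrict_ext)
          (simp add: snd_J_Nc[OF f] inv_mult_group composition_rule action_closed)
      finally show ?thesis
        by (simp add: snd_J_Nc[OF f])
    qed
  qed (use closed is_group in auto)
  moreover have "finite (fst ?J)"
    using assms by (auto simp: fst_J_Nc finite_gset_def intro!: finite_PiE)
  ultimately show ?thesis
    by (simp add: finite_gset_def)
qed

text \<open>Currying: the \<open>i\<close>-th component of the value at \<open>x\<close> becomes the
  value at \<open>(i, x)\<close>. Equivariance holds because the group moves only the points of
  \<open>X\<close>, not the indices.\<close>

lemma J_Nc_copies_iso:
  assumes X: "gset K X" and a: "a \<in> A"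
    and iso: "gset_iso K (gset_copies I X) Y"
  shows "gset_iso K (J_Nc K (I \<rightarrow>\<^sub>E A) (\<lambda>i\<in>I. a) X) (J_Nc K A a Y)"
proof -
  interpret group_action K "fst X" "snd X" by fact
  interpret group K by (rule group_acting)
  let ?P = "I \<rightarrow>\<^sub>E A" and ?p = "\<lambda>i\<in>I. a"
  let ?JX = "J_Nc K ?P ?p X" and ?JY = "J_Nc K A a Y"
  let ?DP = "{?p} <+> ({1} \<rightarrow>\<^sub>E (?P - {?p})) :: ((_ \<Rightarrow> _) + (nat \<Rightarrow> _)) set"
  let ?DA = "{a} <+> ({1} \<rightarrow>\<^sub>E (A - {a})) :: (_ + (nat \<Rightarrow> _)) set"
  have dA: "bij_betw decode ?DA A"
    using a by (rule bij_betw_decode)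
  have dP: "bij_betw decode ?DP ?P"
    using a by (intro bij_betw_decode) auto
  \<comment> \<open>\<open>eA\<close> and \<open>eP\<close> are the inverse codings. Letters pass
    between the two alphabets by decoding, taking or forming tuples, and encoding again.\<close>
  define eA where "eA = inv_into ?DA decode"
  define eP where "eP = inv_into ?DP decode"
  have eA: "eA x \<in> ?DA" "decode (eA x) = x" if "x \<in> A" for x
    using that dA bij_betw_inv_into_right[OF dA] bij_betw_apply[OF bij_betw_inv_into[OF dA]]
    by (auto simp: eA_def)
  have eP: "eP x \<in> ?DP" "decode (eP x) = x" if "x \<in> ?P" for x
    using bij_betw_inv_into_right[OF dP that] bij_betw_apply[OF bij_betw_inv_into[OF dP] that]
    by (auto simp: eP_def)
  have deA: "decode u \<in> A" "eA (decode u) = u" if "u \<in> ?DA" for u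
    using bij_betw_apply[OF dA that] bij_betw_inv_into_left[OF dA that] by (auto simp: eA_def)
  have deP: "decode u \<in> ?P" "eP (decode u) = u" if "u \<in> ?DP" for u
    using bij_betw_apply[OF dP that] bij_betw_inv_into_left[OF dP that] by (auto simp: eP_def)
  obtain \<phi> where \<phi>: "bij_betw \<phi> (I \<times> fst X) (fst Y)"
    and \<phi>eq: "\<And>k i x. k \<in> carrier K \<Longrightarrow> i \<in> I \<Longrightarrow> x \<in> fst X \<Longrightarrow>
      \<phi> (i, snd X k x) = snd Y k (\<phi> (i, x))"
    using iso by (auto simp: gset_iso_def gset_copies_def)
  \<comment> \<open>\<open>\<psi>\<close> splits a point of \<open>Y\<close> into the index of its
    copy and the underlying point of \<open>X\<close>.\<close>
  define \<psi> where "\<psi> = inv_into (I \<times> fst X) \<phi>"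
  have \<psi>: "\<psi> y \<in> I \<times> fst X" "\<phi> (\<psi> y) = y" if "y \<in> fst Y" for y
    using bij_betw_inv_into_right[OF \<phi> that] bij_betw_apply[OF bij_betw_inv_into[OF \<phi>] that]
    by (auto simp: \<psi>_def)
  have \<phi>Y: "\<phi> (i, x) \<in> fst Y" "\<psi> (\<phi> (i, x)) = (i, x)" if "i \<in> I" "x \<in> fst X" for i x
    using bij_betw_apply[OF \<phi>, of "(i, x)"] bij_betw_inv_into_left[OF \<phi>, of "(i, x)"] that
    by (auto simp: \<psi>_def)
  \<comment> \<open>\<open>F\<close> uncurries and \<open>E\<close> curries; they turn out to be
    mutually inverse.\<close>
  define F where "F = (\<lambda>f. \<lambda>y\<in>fst Y. eA (decode (f (snd (\<psi> y))) (fst (\<psi> y))))"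
  define E where "E = (\<lambda>g. \<lambda>x\<in>fst X. eP (\<lambda>i\<in>I. decode (g (\<phi> (i, x)))))"
  have fval: "decode (f x) \<in> ?P" if "f \<in> fst ?JX" "x \<in> fst X" for f x
    using that by (intro deP) (auto simp: fst_J_Nc)
  have F\<phi>: "F f (\<phi> (i, x)) = eA (decode (f x) i)" if "i \<in> I" "x \<in> fst X" for f i x
    using \<phi>Y[OF that] by (simp add: F_def)
  have Fin: "F f \<in> fst ?JY" if f: "f \<in> fst ?JX" for f
    unfolding fst_J_Nc F_def
  proof (rule restrict_PiE_iff[THEN iffD2], intro ballI eA)
    fix y assume "y \<in> fst Y"
    then show "decode (f (snd (\<psi> y))) (fst (\<psi> y)) \<in> A"
      using \<psi>(1)[of y] fval[OF f, of "snd (\<psi> y)"] by (auto simp: mem_Times_iff)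
  qed
  have gval: "(\<lambda>i\<in>I. decode (g (\<phi> (i, x)))) \<in> ?P" if "g \<in> fst ?JY" "x \<in> fst X" for g x
    using that(1) \<phi>Y(1)[OF _ that(2)] unfolding fst_J_Nc restrict_PiE_iff
    by (intro ballI deA(1)) (rule PiE_mem)
  have Ein: "E g \<in> fst ?JX" if "g \<in> fst ?JY" for g
    using gval[OF that] eP unfolding fst_J_Nc E_def by (intro restrict_PiE_iff[THEN iffD2]) blast
  have "E (F f) = f" if f: "f \<in> fst ?JX" for f
  proof (rule extensionalityI[of _ "fst X"])
    fix x assume x: "x \<in> fst X"
    have "(\<lambda>i\<in>I. decode (F f (\<phi> (i, x)))) = decode (f x)"
    proof (rule extensionalityI[of _ I])
      fix i assume i: "i \<in> I"
      then have "decode (f x) i \<in> A"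
        using fval[OF f x] by auto
      then show "(\<lambda>i\<in>I. decode (F f (\<phi> (i, x)))) i = decode (f x) i"
        using i x F\<phi> eA by simp
    qed (use fval[OF f x] in \<open>auto simp: PiE_iff\<close>)
    moreover have "f x \<in> ?DP"
      using f x by (auto simp: fst_J_Nc)
    ultimately show "E (F f) x = f x"
      using x deP by (simp add: E_def)
  qed (use f in \<open>auto simp: E_def fst_J_Nc PiE_iff\<close>)
  moreover have "F (E g) = g" if g: "g \<in> fst ?JY" for g
  proof (rule extensionalityI[of _ "fst Y"])
    fix y assume y: "y \<in> fst Y"
    then obtain i x where ix: "\<psi> y = (i, x)" "i \<in> I" "x \<in> fst X" "\<phi> (i, x) = y"
      using \<psi> by (metis mem_Times_iff prod.collapse)
    have "g y \<in> ?DA"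
      using g y by (auto simp: fst_J_Nc)
    then show "F (E g) y = g y"
      using y ix eP(2)[OF gval[OF g ix(3)]] deA by (simp add: F_def E_def)
  qed (use g in \<open>auto simp: F_def fst_J_Nc PiE_iff\<close>)
  ultimately have "bij_betw F (fst ?JX) (fst ?JY)"
    using Fin Ein by (intro bij_betw_byWitness[where f' = E]) auto
  moreover have "F (snd ?JX k f) = snd ?JY k (F f)" if k: "k \<in> carrier K" and f: "f \<in> fst ?JX" for k f
  proof (rule extensionalityI[of _ "fst Y"])
    fix y assume y: "y \<in> fst Y"
    then obtain i x where ix: "i \<in> I" "x \<in> fst X" "y = \<phi> (i, x)"
      using \<psi> by (metis mem_Times_iff prod.collapse)
    have x': "snd X (inv\<^bsub>K\<^esub> k) x \<in> fst X"
      using k ix action_closed by simp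
    have "F (snd ?JX k f) y = eA (decode (f (snd X (inv\<^bsub>K\<^esub> k) x)) i)"
      using ix F\<phi> by (simp add: snd_J_Nc[OF f])
    \<comment> \<open>\<open>\<phi>\<close> intertwines the actions of \<open>inv k\<close>: moving
      \<open>x\<close> within copy \<open>i\<close> is moving \<open>y\<close> in
      \<open>Y\<close>.\<close>
    also have "\<dots> = F f (snd Y (inv\<^bsub>K\<^esub> k) y)"
      using F\<phi>[OF ix(1) x'] \<phi>eq[of "inv\<^bsub>K\<^esub> k" i x] ix k by simp
    also have "\<dots> = snd ?JY k (F f) y"
      using y by (simp add: snd_J_Nc[OF Fin[OF f]])
    finally show "F (snd ?JX k f) y = snd ?JY k (F f) y" .
  qed (use snd_J_Nc[OF Fin[OF f]] in \<open>auto simp: F_def\<close>)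
  ultimately show ?thesis
    unfolding gset_iso_def by blast
qed

section \<open>Restriction to a subgroup\<close>

lemma subgroup_class_representative:
  assumes "group K" "\<V> \<in> subgroup_classes K" "V \<in> \<V>"
  shows "subgroup V K"
proof -
  interpret group_action K "{H. subgroup H K}"
    "\<lambda>g. \<lambda>H\<in>{H. subgroup H K}. g <#\<^bsub>K\<^esub> H #>\<^bsub>K\<^esub> (inv\<^bsub>K\<^esub> g)"
    using assms(1) by (rule group.action_by_conjugation_on_subgroups_set)
  show ?thesis
    using orbits_subset assms unfolding subgroup_classes_def by blast
qed

text \<open>The stabilizers of the points of \<open>Q\<close> form a full conjugacy class, and
  \<open>Q\<close> is isomorphic to \<open>K/V\<close> precisely when \<open>V\<close> is one of
  them. So exactly one class has its representative among them.\<close>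

lemma ex1_subgroup_class:
  assumes Z: "gset K Z" and Q: "Q \<in> orbits K (fst Z) (snd Z)"
    and rep: "\<And>\<V>. \<V> \<in> subgroup_classes K \<Longrightarrow> rep \<V> \<in> \<V>"
  shows "\<exists>!\<V>. \<V> \<in> subgroup_classes K \<and> gset_iso K (gset_sub Z Q) (coset_gset K (rep \<V>))"
proof -
  interpret group_action K "fst Z" "snd Z" by fact
  interpret group K by (rule group_acting)
  let ?conj = "\<lambda>g. \<lambda>H\<in>{H. subgroup H K}. g <#\<^bsub>K\<^esub> H #>\<^bsub>K\<^esub> (inv\<^bsub>K\<^esub> g)"
  interpret conj: group_action K "{H. subgroup H K}" ?conj
    by (rule action_by_conjugation_on_subgroups_set)
  obtain x where x: "x \<in> Q" "x \<in> fst Z"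
    using orbits_nonempty[OF Q] by blast
  let ?stab = "stabilizer K (snd Z)"
  have S: "subgroup (?stab x) K"
    using stabilizer_subgroup[OF x(2)] .
  have orb: "orbit K ?conj (?stab x) = ?stab ` Q"
    unfolding orbits_eq_orbit[OF Q x(1)]
    using S stabilizer_image[OF x(2)] by (force simp: orbit_def)
  have cl: "orbit K ?conj (?stab x) \<in> subgroup_classes K"
    using S by (auto simp: subgroup_classes_def orbits_def)
  have iff: "gset_iso K (gset_sub Z Q) (coset_gset K (rep \<V>)) \<longleftrightarrow> rep \<V> \<in> ?stab ` Q"
    if "\<V> \<in> subgroup_classes K" for \<V>
    using orbit_iso_coset_gset_iff[OF Z Q subgroup_class_representative[OF is_group that rep[OF that]]]
    by auto
  show ?thesis
  proof (rule ex1I[of _ "orbit K ?conj (?stab x)"])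
    show "orbit K ?conj (?stab x) \<in> subgroup_classes K \<and>
        gset_iso K (gset_sub Z Q) (coset_gset K (rep (orbit K ?conj (?stab x))))"
      using cl iff[OF cl] rep[OF cl] orb by simp
  next
    fix \<V> assume V: "\<V> \<in> subgroup_classes K \<and> gset_iso K (gset_sub Z Q) (coset_gset K (rep \<V>))"
    then have "rep \<V> \<in> orbit K ?conj (?stab x)"
      using iff[of \<V>] orb by simp
    then have "orbit K ?conj (rep \<V>) = orbit K ?conj (?stab x)"
      using S by (intro conj.orbit_eqI) simp
    moreover have "\<V> = orbit K ?conj (rep \<V>)"
      using V rep by (intro conj.orbits_eq_orbit) (auto simp: subgroup_classes_def)
    ultimately show "\<V> = orbit K ?conj (?stab x)"
      by simp
  qed
qed

lemma gset_coset_gset: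
  assumes "group K" "subgroup H K"
  shows "gset K (coset_gset K H)"
proof -
  interpret group K by fact
  note H = subgroup.subset[OF assms(2)]
  have *: "g <#\<^bsub>K\<^esub> (h <#\<^bsub>K\<^esub> H) = (g \<otimes>\<^bsub>K\<^esub> h) <#\<^bsub>K\<^esub> H"
    if "g \<in> carrier K" "h \<in> carrier K" for g h
    using lcos_m_assoc[OF H that] .
  have closed: "g <#\<^bsub>K\<^esub> C \<in> lcosets\<^bsub>K\<^esub> H" if "g \<in> carrier K" "C \<in> lcosets\<^bsub>K\<^esub> H" for g C
    using that * by (auto simp: LCOSETS_def)
  show ?thesis
    using closed is_group
    by (intro group_actionI) (auto simp: coset_gset_def, auto simp: LCOSETS_def * m_assoc)
qed

lemma finite_subgroup_classes:
  assumes "finite (carrier K)"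
  shows "finite (subgroup_classes K)"
proof -
  have "finite {H. subgroup H K}"
    using assms by (rule finite_subset[rotated, OF finite_Pow_iff[THEN iffD2]])
      (auto dest: subgroup.subset)
  then show ?thesis
    by (simp add: subgroup_classes_def orbits_def)
qed

section \<open>Restriction of actions from \<open>G'\<close> to \<open>G\<close>\<close>

context
  fixes G G' :: "('g, 'm) monoid_scheme"
  assumes group_G': "group G'" and sub: "subgroup (carrier G) G'"
    and G_eq: "G = G'\<lparr>carrier := carrier G\<rparr>"
begin

lemma group_G: "group G"
  using subgroup.subgroup_is_group[OF sub group_G'] G_eq by simp

lemma subgroup_ops:
  shows "mult G = mult G'" and "one G = one G'" and "carrier G \<subseteq> carrier G'"
  using arg_cong[OF G_eq, of mult] arg_cong[OF G_eq, of one] subgroup.subset[OF sub] by simp_all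

lemma subgroup_inv: "k \<in> carrier G \<Longrightarrow> inv\<^bsub>G\<^esub> k = inv\<^bsub>G'\<^esub> k"
  using group.m_inv_consistent[OF group_G' sub] G_eq by metis

lemma gset_gset_res:
  assumes "gset G' Z"
  shows "gset G (gset_res G Z)"
proof -
  interpret group_action G' "fst Z" "snd Z" by fact
  show ?thesis
    using subgroup_ops composition_rule action_one action_closed action_extensional group_G
      subgroup.one_closed[OF sub] subgroup.m_closed[OF sub]
    by (intro group_actionI) (auto simp: gset_res_def subset_iff)
qed

lemma finite_gset_res: "finite_gset G' Z \<Longrightarrow> finite_gset G (gset_res G Z)"
  using gset_gset_res[of Z] by (auto simp: finite_gset_def gset_res_def)

lemma gset_iso_res:
  assumes "gset_iso G' Z W"
  shows "gset_iso G (gset_res G Z) (gset_res G W)"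
  using assms subgroup_ops(3) by (fastforce simp: gset_iso_def gset_res_def)

text \<open>Restriction keeps the underlying set and the action of elements of \<open>G\<close>, and
  inverses in \<open>G\<close> and \<open>G'\<close> agree, so the identity is an
  isomorphism.\<close>

lemma J_Nc_res_iso: "gset_iso G (J_Nc G C c (gset_res G Z)) (gset_res G (J_Nc G' C c Z))"
proof -
  have "snd (J_Nc G C c (gset_res G Z)) k f = snd (gset_res G (J_Nc G' C c Z)) k f"
    if "k \<in> carrier G" "f \<in> fst (J_Nc G C c (gset_res G Z))" for k f
    using that group.inv_closed[OF group_G]
    by (simp add: J_Nc_def Let_def gset_res_def subgroup_inv[symmetric])
  then show ?thesis
    unfolding gset_iso_def by (intro exI[of _ id]) (auto simp: fst_J_Nc gset_res_def)
qed

text \<open>A \<open>G\<close>-orbit lies in the \<open>G'\<close>-orbit of any of its points and in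
  no other, since distinct \<open>G'\<close>-orbits are disjoint; the count therefore
  splits.\<close>

lemma orbit_mult_res:
  assumes Z: "finite_gset G' Z"
  shows "orbit_mult G H (gset_res G Z) =
    (\<Sum>Q\<in>orbits G' (fst Z) (snd Z). orbit_mult G H (gset_res G (gset_sub Z Q)))"
proof -
  let ?R = "gset_res G Z" and ?O = "orbits G' (fst Z) (snd Z)"
  have actZ: "gset G' Z"
    using Z by (simp add: finite_gset_def)
  have actR: "gset G ?R"
    using actZ by (rule gset_gset_res)
  interpret Z: group_action G' "fst Z" "snd Z" by fact
  interpret R: group_action G "fst ?R" "snd ?R" by fact
  let ?T = "\<lambda>Q. {R \<in> orbits G (fst ?R) (snd ?R). R \<subseteq> Q \<and>
    gset_iso G (gset_sub ?R R) (coset_gset G H)}"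
  have T: "orbit_mult G H (gset_res G (gset_sub Z Q)) = card (?T Q)" if Q: "Q \<in> ?O" for Q
  proof -
    \<comment> \<open>The inclusion of \<open>Q\<close>, written as \<open>id\<close>, is an
      embedding of restricted \<open>G\<close>-sets.\<close>
    have "orbit_mult G H (gset_res G (gset_sub Z Q)) =
      card (?T (id ` fst (gset_res G (gset_sub Z Q))))"
      using gset_gset_res[OF gset_gset_sub[OF actZ Q]] actR
      by (rule orbit_mult_embedding)
         (use Z.orbits_subset[OF Q] in \<open>auto simp: gset_res_def gset_sub_def\<close>)
    then show ?thesis
      by (simp add: gset_res_def gset_sub_def)
  qed
  have sub: "\<exists>Q\<in>?O. R \<subseteq> Q" if R: "R \<in> orbits G (fst ?R) (snd ?R)" for R
  proof -
    obtain z where "z \<in> fst Z" "R = orbit G (snd ?R) z"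
      using R by (auto simp: orbits_def gset_res_def)
    then show ?thesis
      using subgroup_ops(3)
      by (intro bexI[of _ "orbit G' (snd Z) z"]) (auto simp: orbit_def orbits_def gset_res_def)
  qed
  have "orbit_mult G H ?R = card (\<Union>Q\<in>?O. ?T Q)"
    unfolding orbit_mult_alt using sub by (intro arg_cong[of _ _ card]) blast
  also have "\<dots> = (\<Sum>Q\<in>?O. card (?T Q))"
  proof (rule card_UN_disjoint)
    show "finite ?O"
      using Z by (simp add: finite_orbits finite_gset_def)
    show "\<forall>Q\<in>?O. finite (?T Q)"
      using finite_gset_res[OF Z] by (simp add: finite_orbits finite_gset_def)
    show "\<forall>Q\<in>?O. \<forall>Q'\<in>?O. Q \<noteq> Q' \<longrightarrow> ?T Q \<inter> ?T Q' = {}"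
    proof (intro ballI impI, rule ccontr)
      fix Q Q' assume QQ: "Q \<in> ?O" "Q' \<in> ?O" "Q \<noteq> Q'" and "?T Q \<inter> ?T Q' \<noteq> {}"
      then obtain R where "R \<in> orbits G (fst ?R) (snd ?R)" "R \<subseteq> Q" "R \<subseteq> Q'"
        by blast
      then show False
        using R.orbits_nonempty Z.disjoint_union[OF QQ(1,2)] QQ(3) by blast
    qed
  qed
  finally show ?thesis
    using T by simp
qed

text \<open>The \<open>G'\<close>-orbits are grouped by class: each orbit isomorphic to
  \<open>G'/V\<close> contributes the coefficient of \<open>V\<close>, and there are as many of them
  as the multiplicity of \<open>V\<close>.\<close>

lemma orbit_mult_res_eq_sum_subgroup_classes:
  assumes Z: "finite_gset G' Z" and fin: "finite (carrier G')"
    and rep: "\<And>\<V>. \<V> \<in> subgroup_classes G' \<Longrightarrow> rep \<V> \<in> \<V>"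
  shows "orbit_mult G H (gset_res G Z) =
    (\<Sum>\<V>\<in>subgroup_classes G'. res_coeff G' G (rep \<V>) H * orbit_mult G' (rep \<V>) Z)"
proof -
  let ?O = "orbits G' (fst Z) (snd Z)" and ?\<Phi> = "subgroup_classes G'"
  let ?T = "\<lambda>Q \<V>. gset_iso G' (gset_sub Z Q) (coset_gset G' (rep \<V>))"
  have actZ: "gset G' Z" and finO: "finite ?O"
    using Z by (simp_all add: finite_gset_def finite_orbits)
  have finPhi: "finite ?\<Phi>"
    using fin by (rule finite_subgroup_classes)
  \<comment> \<open>An isomorphism over \<open>G'\<close> restricts to one over \<open>G\<close>, so
    an orbit of type \<open>V\<close> counts like \<open>G'/V\<close>.\<close>
  have coeff: "orbit_mult G H (gset_res G (gset_sub Z Q)) = res_coeff G' G (rep \<V>) H"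
    if "Q \<in> ?O" "\<V> \<in> ?\<Phi>" "?T Q \<V>" for Q \<V>
    unfolding res_coeff_def using that actZ group_G' rep
    by (intro orbit_mult_cong gset_iso_res gset_gset_res gset_gset_sub gset_coset_gset
        subgroup_class_representative) auto
  \<comment> \<open>Written as a sum over all classes with at most one nonzero term, so that the
    order of summation can be exchanged.\<close>
  have "orbit_mult G H (gset_res G (gset_sub Z Q)) =
      (\<Sum>\<V>\<in>?\<Phi>. if ?T Q \<V> then res_coeff G' G (rep \<V>) H else 0)" if Q: "Q \<in> ?O" for Q
  proof -
    have ex1: "\<exists>!\<V>. \<V> \<in> ?\<Phi> \<and> ?T Q \<V>"
      using actZ Q rep by (rule ex1_subgroup_class)
    define \<V> where "\<V> = (THE \<V>. \<V> \<in> ?\<Phi> \<and> ?T Q \<V>)"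
    have V: "\<V> \<in> ?\<Phi>" "?T Q \<V>"
      using theI'[OF ex1] unfolding \<V>_def by (rule conjunct1, rule conjunct2)
    have uniq: "\<W> = \<V>" if "\<W> \<in> ?\<Phi>" "?T Q \<W>" for \<W>
      unfolding \<V>_def by (rule the1_equality[OF ex1 conjI[OF that], symmetric])
    have "(\<Sum>\<W>\<in>?\<Phi>. if ?T Q \<W> then res_coeff G' G (rep \<W>) H else 0) =
        (\<Sum>\<W>\<in>?\<Phi>. if \<W> = \<V> then res_coeff G' G (rep \<V>) H else 0)"
    proof (rule sum.cong[OF refl])
      fix \<W> assume W: "\<W> \<in> ?\<Phi>"
      show "(if ?T Q \<W> then res_coeff G' G (rep \<W>) H else 0) =
          (if \<W> = \<V> then res_coeff G' G (rep \<V>) H else 0)"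
        using V(2) uniq[OF W] by (cases "\<W> = \<V>") auto
    qed
    then show ?thesis
      using V finPhi coeff[OF Q V] by simp
  qed
  then have "orbit_mult G H (gset_res G Z) =
      (\<Sum>Q\<in>?O. \<Sum>\<V>\<in>?\<Phi>. if ?T Q \<V> then res_coeff G' G (rep \<V>) H else 0)"
    by (simp add: orbit_mult_res[OF Z])
  also have "\<dots> = (\<Sum>\<V>\<in>?\<Phi>. \<Sum>Q\<in>?O. if ?T Q \<V> then res_coeff G' G (rep \<V>) H else 0)"
    by (rule sum.swap)
  \<comment> \<open>The inner sum repeats a constant once for each orbit of the given type.\<close>
  also have "\<dots> = (\<Sum>\<V>\<in>?\<Phi>. res_coeff G' G (rep \<V>) H * orbit_mult G' (rep \<V>) Z)"
    using finO by (intro sum.cong refl)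
      (simp add: orbit_mult_alt sum.If_cases Int_def mult.commute)
  finally show ?thesis .
qed

end

text \<open>Quantifying over every choice \<open>rep\<close> and every \<open>H\<close> in its class
  makes the formula independent of representatives.\<close>

theorem theorem3p21:
  fixes G G' :: "('g, 'm) monoid_scheme"
    and X :: "('g, 'x) gset" and Y :: "('g, 'y) gset"
    and r :: nat
    and A :: "'a set" and a :: 'a
    and P :: "(nat \<Rightarrow> 'a) set" and p :: "nat \<Rightarrow> 'a"
  assumes "group G" and "finite (carrier G)"
    and "finite_gset G X"
    and "r \<ge> 1"
    and "finite A" and "card A \<ge> 2" and "a \<in> A"
    and "P = {1..r} \<rightarrow>\<^sub>E A" and "p = (\<lambda>i\<in>{1..r}. a)"
    and "group G'" and "finite (carrier G')"
    and "subgroup (carrier G) G'" and "G = G'\<lparr>carrier := carrier G\<rparr>"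
    and "finite_gset G' Y"
    and "burnside_class G (gset_res G Y) = [r] \<cdot>\<^bsub>burnside_ring G\<^esub> burnside_class G X"
  shows "gset_iso G (J_Nc G P p X) (gset_res G (J_Nc G' A a Y)) \<and>
    (\<forall>rep. (\<forall>\<V>\<in>subgroup_classes G'. rep \<V> \<in> \<V>) \<longrightarrow>
      (\<forall>\<H>\<in>subgroup_classes G. \<forall>H\<in>\<H>.
        orbit_mult G H (J_Nc G P p X) =
          (\<Sum>\<V>\<in>subgroup_classes G'.
             res_coeff G' G (rep \<V>) H * orbit_mult G' (rep \<V>) (J_Nc G' A a Y))))"
proof -
  note res = assms(10,12,13)
  have copies: "finite_gset G (gset_copies {1..r} X)"
    using assms(3) by (rule finite_gset_copies) simp
  have JX: "finite_gset G (J_Nc G P p X)"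
    using assms(3,5,8) by (auto intro!: finite_gset_J_Nc finite_PiE)
  have JY: "finite_gset G' (J_Nc G' A a Y)"
    using assms(14,5) by (rule finite_gset_J_Nc)
  \<comment> \<open>The equation in \<open>B(G)\<close> is rewritten as an equality of classes of
    two actual \<open>G\<close>-sets, to which cancellation applies.\<close>
  have "burnside_class G (gset_copies {1..r} X) = burnside_class G (gset_res G Y)"
    using assms(15) burnside_class_add_pow[OF assms(3)] by simp
  then have "gset_iso G (gset_copies {1..r} X) (gset_res G Y)"
    using burnside_class_eq_iff[OF copies finite_gset_res[OF res assms(14)]] by blast
  then have "gset_iso G (J_Nc G P p X) (J_Nc G A a (gset_res G Y))"
    unfolding assms(8,9) using assms(3,7) by (intro J_Nc_copies_iso) (auto simp: finite_gset_def)
  then have iso: "gset_iso G (J_Nc G P p X) (gset_res G (J_Nc G' A a Y))"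
    using J_Nc_res_iso[OF res] by (rule gset_iso_trans)
  have "orbit_mult G H (J_Nc G P p X) = orbit_mult G H (gset_res G (J_Nc G' A a Y))" for H
    using JX finite_gset_res[OF res JY] iso by (intro orbit_mult_cong) (auto simp: finite_gset_def)
  then show ?thesis
    using iso orbit_mult_res_eq_sum_subgroup_classes[OF res JY assms(11)] by auto
qed

end
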